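(* Let $\Sigma=\{\mathtt{a},\mathtt{b}\}$ and let $k,m\in\mathbb{N}_0$ with $m<k$. Let $N_k^m$ be the number of congruence classes of $\sim_k$ on $\Sigma^*$ that consist of words $w$ with $\iota(w)=m$. Then \[ N_k^m=\left\| \begin{pmatrix} k-m & k-m & k-m\\ 1 & 2 & 1\\ k-m & k-m & k-m\end{pmatrix}^{m}\cdot\begin{pmatrix}k-m\\1\\k-m\end{pmatrix}\right\|_1 = c_k^m, \] where $\|\cdot\|_1$ is the $1$-norm and the numbers $c_j^n$ are defined by $c_j^{-1}\coloneqq 1$, $c_j^0\coloneqq 2j+1$, and $c_j^n\coloneqq 2(j-n+1)\,c_{j-1}^{n-1}-2(j-n)\,c_{j-2}^{n-2}$ for $n\geq 1$.
   Context: A word $u$ is a scattered factor of $w$ if $u$ is obtained from $w$ by deleting some letters (keeping order). For $k\in\mathbb{N}_0$, $u\sim_k v$ iff $u$ and $v$ have exactly the same scattered factors of length at most $k$ (Simon's congruence). $\iota(w)$ is the largest $\ell$ such that every word of $\Sigma^\ell$ is a scattered factor of $w$ (equivalently, the number of arches in the greedy factorization of $w$ into minimal prefixes containing both letters). If $u\sim_k v$ then either both have $\iota\ge k$ or $\iota(u)=\iota(v)$, so for $m<k$ each class consists either entirely of words with $\iota=m$ or of none. *)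

theory Defs
  imports "HOL-Library.Sublist" "Jordan_Normal_Form.Matrix"
begin

datatype letter = Letter_a | Letter_b

text \<open>Scattered factors are the library's (not necessarily contiguous) subsequences
  \<^const>\<open>subseq\<close>.\<close>

definition scattered_factors_upto :: "nat \<Rightarrow> letter list \<Rightarrow> letter list set" where
  "scattered_factors_upto k w = {u. subseq u w \<and> length u \<le> k}"

definition simon_cong :: "nat \<Rightarrow> (letter list \<times> letter list) set" where
  "simon_cong k = {(u, v). scattered_factors_upto k u = scattered_factors_upto k v}"

text \<open>The maximum exists: the empty word is a scattered factor of \<open>w\<close>, and no word longer
  than \<open>w\<close> is one.\<close>

definition universality_index :: "letter list \<Rightarrow> nat" (\<open>\<iota>\<close>) where
  "\<iota> w = (GREATEST l. \<forall>u. length u = l \<longrightarrow> subseq u w)"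

definition num_classes :: "nat \<Rightarrow> nat \<Rightarrow> nat" where
  "num_classes k m = card {C \<in> UNIV // simon_cong k. \<forall>w \<in> C. \<iota> w = m}"

definition norm_one :: "'a :: linordered_idom vec \<Rightarrow> 'a" where
  "norm_one v = (\<Sum>i<dim_vec v. \<bar>v $ i\<bar>)"

definition class_mat :: "int \<Rightarrow> int mat" where
  "class_mat d = mat_of_rows_list 3
     [[d, d, d],
      [1, 2, 1],
      [d, d, d]]"

definition class_vec :: "int \<Rightarrow> int vec" where
  "class_vec d = vec_of_list [d, 1, d]"

text \<open>\<open>c_num j n\<close> is $c_j^n$. The sequence starts at \<open>n = -1\<close>; the value 1 at \<open>n < -1\<close> only serves
  to make the function total and is never reached from \<open>n \<ge> -1\<close>.\<close>

function c_num :: "int \<Rightarrow> int \<Rightarrow> int" where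
  "c_num j n =
     (if n \<le> -1 then 1
      else if n = 0 then 2 * j + 1
      else 2 * (j - n + 1) * c_num (j - 1) (n - 1) - 2 * (j - n) * c_num (j - 2) (n - 2))"
  by auto
termination by (relation "measure (\<lambda>(j, n). nat (n + 1))") auto

declare c_num.simps [simp del]

end

theory Submission
  imports Defs
begin

text \<open>
  Factorise a word \<open>w\<close> with \<open>\<iota> w = m < k\<close> as \<open>\<alpha>\<^sub>0 \<beta>\<^sub>1 \<alpha>\<^sub>1 \<dots> \<beta>\<^sub>m \<alpha>\<^sub>m\<close>, where the \<open>\<alpha>\<^sub>i\<^sub>-\<^sub>1 \<beta>\<^sub>i\<close> are its
  arches read from the left and the \<open>\<beta>\<^sub>i \<alpha>\<^sub>i\<close> those read from the right. Over two letters every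
  \<open>\<alpha>\<^sub>i\<close> is a power of one letter, and \<open>\<beta>\<^sub>i\<close> is determined by the letters of \<open>\<alpha>\<^sub>i\<^sub>-\<^sub>1\<close> and \<open>\<alpha>\<^sub>i\<close>, except
  that it can be \<open>ab\<close> or \<open>ba\<close> if both are empty.
  Exponents above \<open>d = k - m\<close> are invisible to the congruence: a scattered factor of length at
  most \<open>k\<close> that uses more than \<open>d\<close> letters of \<open>\<alpha>\<^sub>i\<close> has fewer than \<open>i\<close> letters before them or fewer
  than \<open>m - i\<close> after them, so one letter can be moved into the universal context.
  Conversely, congruent words with exponents at most \<open>d\<close> are equal: deleting the first arch of
  both leaves words congruent for \<open>k - 1\<close>, and \<open>\<alpha>\<^sub>0\<close> is recovered from the words \<open>x\<^sup>j u\<close> with \<open>u\<close>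
  ranging over all words of length \<open>m\<close>. Counting the truncated factorisations by the letter of
  \<open>\<alpha>\<^sub>0\<close> gives the matrix, and its characteristic polynomial the recursion.
\<close>

section \<open>Universality and arches\<close>

lemma subseq_set: "subseq xs ys \<Longrightarrow> set xs \<subseteq> set ys"
  by (auto elim: list_emb_set)

lemma subseq_replicate_iff: "subseq s (replicate n x) \<longleftrightarrow> (\<exists>r\<le>n. s = replicate r x)"
proof
  assume s: "subseq s (replicate n x)"
  then have "set s \<subseteq> {x}"
    using subseq_set by fastforce
  then have "s = replicate (length s) x"
    by (intro replicate_length_same[symmetric]) auto
  then show "\<exists>r\<le>n. s = replicate r x"
    using list_emb_length[OF s] by auto
next
  assume "\<exists>r\<le>n. s = replicate r x"
  then obtain r where "r \<le> n" "s = replicate r x" by blast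
  then have "replicate n x = s @ replicate (n - r) x"
    by (simp add: replicate_add[symmetric])
  then show "subseq s (replicate n x)"
    by (simp add: subseq_rev_drop_many)
qed

fun flip :: "letter \<Rightarrow> letter" where
  "flip Letter_a = Letter_b"
| "flip Letter_b = Letter_a"

lemma flip_flip [simp]: "flip (flip x) = x"
  by (cases x) auto

lemma flip_neq [simp]: "flip x \<noteq> x" "x \<noteq> flip x"
  by (cases x; simp)+

lemma neq_iff_flip: "y \<noteq> x \<longleftrightarrow> y = flip x"
  by (cases x; cases y) auto

lemma UNIV_letter_flip: "(UNIV :: letter set) = {x, flip x}"
  by (auto simp: neq_iff_flip[symmetric])

lemma UNIV_letter_option_flip: "(UNIV :: letter option set) = {None, Some x, Some (flip x)}"
  by (auto simp: UNIV_option_conv UNIV_letter_flip[of x])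

section \<open>Universal words and the universality index\<close>

definition universal :: "nat \<Rightarrow> letter list \<Rightarrow> bool" where
  "universal p w \<longleftrightarrow> (\<forall>u. length u \<le> p \<longrightarrow> subseq u w)"

lemma universalD: "universal p w \<Longrightarrow> length u \<le> p \<Longrightarrow> subseq u w"
  by (simp add: universal_def)

lemma universal_0 [simp]: "universal 0 w"
  by (simp add: universal_def)

lemma universal_mono: "universal p w \<Longrightarrow> q \<le> p \<Longrightarrow> universal q w"
  by (simp add: universal_def)

lemma universal_append: "universal p u \<Longrightarrow> universal q v \<Longrightarrow> universal (p + q) (u @ v)"
  unfolding universal_def
proof (intro allI impI)
  fix s :: "letter list"
  assume u: "\<forall>s. length s \<le> p \<longrightarrow> subseq s u" and v: "\<forall>s. length s \<le> q \<longrightarrow> subseq s v"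
    and s: "length s \<le> p + q"
  have "subseq (take p s @ drop p s) (u @ v)"
    using u v s by (intro list_emb_append_mono) auto
  then show "subseq s (u @ v)" by simp
qed

lemma universal_1:
  assumes "x \<in> set w" "flip x \<in> set w"
  shows "universal 1 w"
  unfolding universal_def
proof (intro allI impI)
  fix s :: "letter list"
  assume "length s \<le> 1"
  then consider "s = []" | z where "s = [z]"
    by (cases s) auto
  then show "subseq s w"
    using assms UNIV_letter_flip[of x] by cases (auto simp: subseq_singleton_left)
qed

text \<open>Padding a shorter word to length \<open>p\<close> makes it a prefix of a tested word.
  This links \<open>universal\<close> to the exact lengths in \<open>\<iota>\<close>.\<close>

lemma universal_iff_length_eq:
  "universal p w \<longleftrightarrow> (\<forall>u. length u = p \<longrightarrow> subseq u w)"
proof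
  assume *: "\<forall>u. length u = p \<longrightarrow> subseq u w"
  show "universal p w"
    unfolding universal_def
  proof (intro allI impI)
    fix u :: "letter list"
    assume "length u \<le> p"
    then have "subseq (u @ replicate (p - length u) Letter_a) w"
      using * by simp
    then show "subseq u w"
      using subseq_order.order_trans prefix_imp_subseq[OF prefixI[OF refl]] by blast
  qed
qed (simp add: universal_def)

lemma universality_index_eqI:
  assumes "universal n w" "\<not> universal (Suc n) w"
  shows "\<iota> w = n"
  unfolding universality_index_def
proof (rule Greatest_equality)
  show "\<forall>u. length u = n \<longrightarrow> subseq u w"
    using assms(1) by (simp add: universal_def)
  fix l assume "\<forall>u. length u = l \<longrightarrow> subseq u w"
  then have "universal l w"
    by (simp add: universal_iff_length_eq)
  then show "l \<le> n"
    using assms(2) universal_mono not_less_eq_eq by blast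
qed

text \<open>The number of arches of the greedy factorisation read from the right, and the remaining
  prefix, which is a power of a single letter.\<close>

fun rarch :: "letter list \<Rightarrow> nat \<times> letter list" where
  "rarch [] = (0, [])"
| "rarch (x # w) = (case rarch w of (n, r) \<Rightarrow> if flip x \<in> set r then (Suc n, []) else (n, x # r))"

lemma rarch_rest_unary:
  assumes "rarch w = (n, r)"
  shows "\<exists>x. flip x \<notin> set r"
  using assms
proof (induction w arbitrary: n r)
  case (Cons z w)
  obtain n' r' where r': "rarch w = (n', r')" by fastforce
  show ?case
    using Cons.prems r' by (cases "flip z \<in> set r'") (auto intro!: exI[of _ z])
qed simp

lemma rarch_universal:
  assumes "rarch w = (n, r)"
  shows "\<exists>v. w = r @ v \<and> universal n v"
  using assms
proof (induction w arbitrary: n r)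
  case (Cons z w)
  obtain n' r' where r': "rarch w = (n', r')" by fastforce
  then obtain v where v: "w = r' @ v" "universal n' v"
    using Cons.IH by blast
  show ?case
  proof (cases "flip z \<in> set r'")
    case True
    then have "universal (1 + n') ((z # r') @ v)"
      by (intro universal_append universal_1[of z] v) auto
    then show ?thesis
      using Cons.prems r' v True by auto
  qed (use Cons.prems r' v in auto)
qed simp

text \<open>The word \<open>u\<close> consists of the first letters of the arches, so matching it from the right
  exhausts all of them.\<close>

lemma rarch_modus:
  assumes "rarch w = (n, r)"
  shows "\<exists>u. length u = n \<and> (\<forall>s. subseq (s @ u) w \<longrightarrow> subseq s r)"
  using assms
proof (induction w arbitrary: n r)
  case (Cons z w)
  obtain n' r' where r': "rarch w = (n', r')" by fastforce
  then obtain u where u: "length u = n'" "\<And>s. subseq (s @ u) w \<Longrightarrow> subseq s r'"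
    using Cons.IH by blast
  show ?case
  proof (cases "flip z \<in> set r'")
    case True
    obtain x where x: "flip x \<notin> set r'"
      using rarch_rest_unary[OF r'] by blast
    then have z: "z \<notin> set r'"
      using True by (metis flip_flip neq_iff_flip)
    have "s = []" if s: "subseq (s @ z # u) (z # w)" for s
    proof (rule ccontr)
      assume "s \<noteq> []"
      then obtain c s' where "s = c # s'" by (cases s) auto
      \<comment> \<open>The head of \<open>z # w\<close> matches at most \<open>c\<close>, so
        \<open>s' @ z # u\<close> embeds in \<open>w\<close>; regrouped for the induction
        hypothesis, this forces \<open>z\<close> into \<open>r'\<close>.\<close>
      with s have "subseq ((s' @ [z]) @ u) w"
        by (auto simp: subseq_Cons2_iff split: if_splits dest: subseq_Cons')
      then have "subseq (s' @ [z]) r'" by (rule u(2))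
      then show False
        using z subseq_set by fastforce
    qed
    then show ?thesis
      using Cons.prems r' u True by (intro exI[of _ "z # u"]) auto
  next
    case False
    have "subseq s (z # r')" if s: "subseq (s @ u) (z # w)" for s
    proof (cases s)
      case (Cons c s')
      then show ?thesis
        using s u(2)[of s] u(2)[of s'] by (auto simp: subseq_Cons2_iff split: if_splits)
    qed simp
    then show ?thesis
      using Cons.prems r' u False by auto
  qed
qed simp

text \<open>A word that exhausts all \<open>n\<close> arches, preceded by a letter missing from the
  rest, has length \<open>n + 1\<close> and is not a scattered factor.\<close>

lemma universality_index_rarch:
  assumes "rarch w = (n, r)"
  shows "universal n w" "\<not> universal (Suc n) w" "\<iota> w = n"
proof -
  obtain v where "w = r @ v" "universal n v"
    using rarch_universal[OF assms] by blast
  then show 1: "universal n w"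
    using universal_append[of 0 r n v] by simp
  obtain x where x: "flip x \<notin> set r"
    using rarch_rest_unary[OF assms] by blast
  obtain u where u: "length u = n" "\<And>s. subseq (s @ u) w \<Longrightarrow> subseq s r"
    using rarch_modus[OF assms] by blast
  show 2: "\<not> universal (Suc n) w"
  proof
    assume "universal (Suc n) w"
    then have "subseq ([flip x] @ u) w"
      using u(1) by (intro universalD) auto
    then have "subseq [flip x] r" by (rule u(2))
    then show False
      using x by (simp add: subseq_singleton_left)
  qed
  show "\<iota> w = n"
    using 1 2 by (rule universality_index_eqI)
qed

section \<open>Simon's congruence\<close>

lemma simon_cong_iff:
  "(u, v) \<in> simon_cong k \<longleftrightarrow> (\<forall>s. length s \<le> k \<longrightarrow> (subseq s u \<longleftrightarrow> subseq s v))"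
  by (auto simp: simon_cong_def scattered_factors_upto_def)

lemma simon_congD: "(u, v) \<in> simon_cong k \<Longrightarrow> length s \<le> k \<Longrightarrow> subseq s u \<longleftrightarrow> subseq s v"
  by (simp add: simon_cong_iff)

lemma equiv_simon_cong: "equiv UNIV (simon_cong k)"
  unfolding equiv_def refl_on_def sym_def trans_def simon_cong_def by auto

lemma simon_cong_trans:
  "(u, v) \<in> simon_cong k \<Longrightarrow> (v, w) \<in> simon_cong k \<Longrightarrow> (u, w) \<in> simon_cong k"
  by (auto simp: simon_cong_iff)

text \<open>Universality for lengths up to \<open>k\<close> is invariant, and
  \<open>\<iota> v < k\<close> lets the failure at \<open>\<iota> v + 1\<close> transfer as
  well.\<close>

lemma simon_cong_universality_index:
  assumes "(u, v) \<in> simon_cong k" "\<iota> v < k"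
  shows "\<iota> u = \<iota> v"
proof -
  obtain n r where r: "rarch v = (n, r)" by fastforce
  have "universal l u \<longleftrightarrow> universal l v" if "l \<le> k" for l
    using assms(1) that by (auto simp: universal_def simon_cong_iff)
  then show ?thesis
    using universality_index_rarch[OF r] assms(2) by (intro universality_index_eqI) auto
qed

section \<open>Truncating powers between universal contexts\<close>

lemma subseq_append_replicate_shrink:
  assumes "universal p u" "universal q v" "d \<le> j" "length s \<le> p + q + d"
    and "subseq s (u @ replicate (Suc j) x @ v)"
  shows "subseq s (u @ replicate j x @ v)"
proof -
  obtain s1 s' where s': "s = s1 @ s'" "subseq s1 u" "subseq s' (replicate (Suc j) x @ v)"
    using assms(5) by (auto simp: subseq_append_iff)
  obtain t s2 where s2: "s' = t @ s2" "subseq t (replicate (Suc j) x)" "subseq s2 v"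
    using iffD1[OF subseq_append_iff s'(3)] by blast
  obtain r where t: "t = replicate r x" and r: "r \<le> Suc j"
    using s2(2) unfolding subseq_replicate_iff by blast
  \<comment> \<open>If all \<open>j + 1 > d\<close> copies are used, \<open>s1\<close> and
    \<open>s2\<close> together have fewer than \<open>p + q\<close> letters, so one context has room
    for another letter.\<close>
  consider "r \<le> j" | "r = Suc j" "length s1 < p" | "r = Suc j" "length s2 < q"
    using r assms(3,4) s' s2 t by fastforce
  then show ?thesis
  proof cases
    case 1
    then have "subseq t (replicate j x)"
      using t by (auto simp: subseq_replicate_iff)
    then show ?thesis
      using s' s2 by (auto intro!: list_emb_append_mono)
  next
    case 2
    then have "subseq (s1 @ [x]) u"
      by (intro universalD[OF assms(1)]) auto
    then have "subseq ((s1 @ [x]) @ replicate j x @ s2) (u @ replicate j x @ v)"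
      using s2(3) by (intro list_emb_append_mono) auto
    then show ?thesis
      using s' s2 t 2 by simp
  next
    case 3
    then have "subseq (x # s2) v"
      by (intro universalD[OF assms(2)]) auto
    then have "subseq (s1 @ replicate j x @ x # s2) (u @ replicate j x @ v)"
      using s'(2) by (intro list_emb_append_mono) auto
    then show ?thesis
      using s' s2 t 3 by (simp add: replicate_app_Cons_same)
  qed
qed

lemma simon_cong_truncate:
  assumes "universal p u" "universal q v"
  shows "(u @ replicate (d + i) x @ v, u @ replicate d x @ v) \<in> simon_cong (p + q + d)"
proof (induction i)
  case 0
  show ?case by (simp add: simon_cong_iff)
next
  case (Suc i)
  have "(u @ replicate (d + Suc i) x @ v, u @ replicate (d + i) x @ v) \<in> simon_cong (p + q + d)"
    unfolding simon_cong_iff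
  proof (intro allI impI iffI)
    fix s :: "letter list"
    assume s: "length s \<le> p + q + d"
    show "subseq s (u @ replicate (d + i) x @ v)" if "subseq s (u @ replicate (d + Suc i) x @ v)"
      using subseq_append_replicate_shrink[OF assms _ s, of "d + i" x] that by simp
    have "subseq (u @ replicate (d + i) x @ v) (u @ replicate (d + Suc i) x @ v)"
      by (auto intro!: list_emb_append_mono)
    then show "subseq s (u @ replicate (d + Suc i) x @ v)" if "subseq s (u @ replicate (d + i) x @ v)"
      using that subseq_order.order_trans by blast
  qed
  then show ?case
    using Suc.IH simon_cong_trans by blast
qed

lemma simon_cong_min:
  assumes "universal p u" "universal q v"
  shows "(u @ replicate j x @ v, u @ replicate (min j d) x @ v) \<in> simon_cong (p + q + d)"
proof (cases "j \<le> d")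
  case True
  then show ?thesis by (simp add: simon_cong_iff min_def)
next
  case False
  then show ?thesis
    using simon_cong_truncate[OF assms, of d "j - d" x] by (simp add: min_def)
qed

section \<open>Normal forms\<close>

text \<open>The last argument of \<open>nf\<close> is the letter occurring in \<open>\<alpha>\<^sub>0\<close>, if any. The factor \<open>\<beta>\<^sub>1\<close> is
  \<open>flip x\<close> if \<open>\<alpha>\<^sub>0\<close> and \<open>\<alpha>\<^sub>1\<close> are both nontrivial powers of \<open>x\<close>, and has length two otherwise.\<close>

fun nf :: "nat \<Rightarrow> nat \<Rightarrow> letter option \<Rightarrow> letter list set" where
  "nf d 0 None = {[]}"
| "nf d 0 (Some x) = (\<lambda>j. replicate j x) ` {1..d}"
| "nf d (Suc n) None =
     (\<Union>x. (\<lambda>v. x # flip x # v) ` (nf d n None \<union> nf d n (Some (flip x))))"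
| "nf d (Suc n) (Some x) =
     (\<lambda>(j, v). replicate j x @ flip x # v) ` ({1..d} \<times> nf d n (Some x)) \<union>
     (\<lambda>(j, v). replicate j x @ x # flip x # v) `
       ({1..d} \<times> (nf d n None \<union> nf d n (Some (flip x))))"

definition power_type :: "nat \<Rightarrow> letter option \<Rightarrow> letter list \<Rightarrow> bool" where
  "power_type d t r \<longleftrightarrow> (case t of None \<Rightarrow> r = [] | Some x \<Rightarrow> \<exists>j\<in>{1..d}. r = replicate j x)"

lemma power_type_simps [simp]:
  "power_type d None r \<longleftrightarrow> r = []"
  "power_type d (Some x) r \<longleftrightarrow> (\<exists>j\<in>{1..d}. r = replicate j x)"
  by (simp_all add: power_type_def)

lemma power_type_unique: "power_type d t r \<Longrightarrow> power_type d t' r \<Longrightarrow> t = t'"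
  by (cases t; cases t') (auto simp: power_type_def replicate_eq_replicate)

lemma power_type_length: "power_type d t r \<Longrightarrow> length r \<le> d"
  by (cases t) auto

lemma rarch_replicate_append:
  assumes "rarch v = (n, [])"
  shows "rarch (replicate j x @ v) = (n, replicate j x)"
  using assms by (induction j) auto

lemma rarch_nf:
  assumes "w \<in> nf d n t"
  shows "\<exists>r. rarch w = (n, r) \<and> power_type d t r"
  using assms
proof (induction n arbitrary: t w)
  case 0
  then show ?case
    using rarch_replicate_append[of "[]" 0] by (cases t) auto
next
  case (Suc n)
  \<comment> \<open>The rest of \<open>v\<close> lacks \<open>x\<close>, so \<open>flip x\<close>
    extends it and \<open>x\<close> closes the arch; in \<open>one\<close>, the rest contains
    \<open>x\<close> and \<open>flip x\<close> closes the arch at once.\<close>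
  have two: "rarch (x # flip x # v) = (Suc n, [])"
    if "v \<in> nf d n None \<union> nf d n (Some (flip x))" for x v
    using that Suc.IH[of v None] Suc.IH[of v "Some (flip x)"] by auto
  have one: "rarch (flip x # v) = (Suc n, [])" if "v \<in> nf d n (Some x)" for x v
    using that Suc.IH[of v "Some x"] by auto
  show ?case
  proof (cases t)
    case None
    then show ?thesis using Suc.prems two by auto
  next
    case (Some x)
    then show ?thesis
      using Suc.prems rarch_replicate_append[OF one] rarch_replicate_append[OF two] by auto
  qed
qed

lemma nf_type_unique: "w \<in> nf d n t \<Longrightarrow> w \<in> nf d n t' \<Longrightarrow> t = t'"
  using rarch_nf power_type_unique by (metis prod.inject)

lemma universality_index_nf: "w \<in> nf d n t \<Longrightarrow> \<iota> w = n"
  using rarch_nf universality_index_rarch(3) by blast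

section \<open>Every word is congruent to a normal form\<close>

lemma unary_or_arch:
  "(\<exists>j x. w = replicate j x) \<or> (\<exists>j x v. w = replicate (Suc j) x @ flip x # v)"
proof (induction w)
  case (Cons z w)
  consider j x where "w = replicate j x" | j x v where "w = replicate (Suc j) x @ flip x # v"
    using Cons by blast
  then show ?case
  proof cases
    case (1 j x)
    show ?thesis
    proof (cases "j = 0 \<or> z = x")
      case True
      then have "z # w = replicate (Suc j) z" using 1 by auto
      then show ?thesis by blast
    next
      case False
      then obtain i where "j = Suc i" "x = flip z"
        by (metis neq_iff_flip not0_implies_Suc)
      then have "z # w = replicate (Suc 0) z @ flip z # replicate i x" using 1 by simp
      then show ?thesis by blast
    qed
  next
    case (2 j x v)
    show ?thesis
    proof (cases "z = x")
      case True
      then have "z # w = replicate (Suc (Suc j)) x @ flip x # v" using 2 by simp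
      then show ?thesis by blast
    next
      case False
      then have "z # w = replicate (Suc 0) z @ flip z # (replicate j x @ flip x # v)"
        using 2 by (metis append_Cons append_Nil neq_iff_flip replicate_0 replicate_Suc)
      then show ?thesis by blast
    qed
  qed
qed (use replicate_0 in metis)

text \<open>As \<open>d \<ge> 1\<close>, truncation keeps positive exponents positive. The type is
  existential because \<open>j\<close> may be 0 in the last two claims.\<close>

lemma replicate_min_nf:
  assumes "d \<ge> 1"
  shows "v \<in> nf d n (Some x) \<Longrightarrow> \<exists>t. replicate (min (Suc j) d) x @ flip x # v \<in> nf d (Suc n) t"
    and "v \<in> nf d n None \<union> nf d n (Some (flip x)) \<Longrightarrow>
      \<exists>t. replicate (min j d) x @ x # flip x # v \<in> nf d (Suc n) t"
    and "\<exists>t. replicate (min j d) x \<in> nf d 0 t"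
proof -
  assume "v \<in> nf d n (Some x)"
  then have "replicate (min (Suc j) d) x @ flip x # v \<in> nf d (Suc n) (Some x)"
    using assms by (auto intro!: image_eqI[of _ _ "(min (Suc j) d, v)"])
  then show "\<exists>t. replicate (min (Suc j) d) x @ flip x # v \<in> nf d (Suc n) t" ..
next
  assume v: "v \<in> nf d n None \<union> nf d n (Some (flip x))"
  have "replicate (min j d) x @ x # flip x # v \<in> nf d (Suc n) (if j = 0 then None else Some x)"
    using assms v by (auto intro!: image_eqI[of _ _ "(min j d, v)"])
  then show "\<exists>t. replicate (min j d) x @ x # flip x # v \<in> nf d (Suc n) t" ..
next
  have "replicate (min j d) x \<in> nf d 0 (if j = 0 then None else Some x)"
    using assms by auto
  then show "\<exists>t. replicate (min j d) x \<in> nf d 0 t" ..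
qed

text \<open>The left context \<open>u\<close> supplies the \<open>p\<close> arches preceding \<open>w\<close>, which makes the induction from
  the right go through.\<close>

lemma ex_nf_simon_cong:
  assumes d: "d \<ge> 1"
  shows "\<exists>n t. \<exists>w'\<in>nf d n t. \<forall>u p. universal p u \<longrightarrow> (u @ w, u @ w') \<in> simon_cong (p + n + d)"
proof (induction "length w" arbitrary: w rule: less_induct)
  case less
  consider j x where "w = replicate j x" | j x v where "w = replicate (Suc j) x @ flip x # v"
    using unary_or_arch by blast
  then show ?case
  proof cases
    case (1 j x)
    obtain t where t: "replicate (min j d) x \<in> nf d 0 t"
      using replicate_min_nf(3)[OF d] by blast
    have "(u @ w, u @ replicate (min j d) x) \<in> simon_cong (p + 0 + d)" if "universal p u" for u p
      using simon_cong_min[OF that universal_0[of "[]"], of j x d] 1 by simp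
    then show ?thesis
      using t by blast
  next
    case (2 j x v)
    then have "length v < length w" by simp
    then obtain n s v' where v': "v' \<in> nf d n s"
      and cong: "\<And>u p. universal p u \<Longrightarrow> (u @ v, u @ v') \<in> simon_cong (p + n + d)"
      using less by metis
    have step: "(u @ w, u @ replicate (Suc j) x @ flip x # v') \<in> simon_cong (p + Suc n + d)"
      if "universal p u" for u p
    proof -
      \<comment> \<open>The first arch of \<open>w\<close> from the left joins the left
        context.\<close>
      have "universal (p + 1) (u @ replicate (Suc j) x @ [flip x])"
        by (intro universal_append that universal_1[of x]) auto
      then show ?thesis
        using cong[of "p + 1" "u @ replicate (Suc j) x @ [flip x]"] 2 by simp
    qed
    show ?thesis
    proof (cases "s = Some x")
      case True
      then obtain t where t: "replicate (min (Suc j) d) x @ flip x # v' \<in> nf d (Suc n) t"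
        using replicate_min_nf(1)[OF d] v' by blast
      obtain r where r: "rarch v' = (n, r)" "power_type d s r"
        using rarch_nf[OF v'] by blast
      then have "rarch (flip x # v') = (Suc n, [])"
        using True by auto
      then have "universal (Suc n) (flip x # v')"
        by (rule universality_index_rarch)
      then have "(u @ replicate (Suc j) x @ flip x # v', u @ replicate (min (Suc j) d) x @ flip x # v')
          \<in> simon_cong (p + Suc n + d)" if "universal p u" for u p
        using simon_cong_min that by blast
      then show ?thesis
        using step t by (blast intro: simon_cong_trans)
    next
      \<comment> \<open>Now one \<open>x\<close> belongs to \<open>\<beta>\<^sub>1\<close>, so only
        the other \<open>j\<close> copies are truncated; in the previous case all
        \<open>Suc j\<close> copies formed \<open>\<alpha>\<^sub>0\<close>.\<close>
      case False
      then have s: "v' \<in> nf d n None \<union> nf d n (Some (flip x))"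
        using v' UNIV_letter_option_flip[of x] by auto
      then obtain t where t: "replicate (min j d) x @ x # flip x # v' \<in> nf d (Suc n) t"
        using replicate_min_nf(2)[OF d] by blast
      have "x # flip x # v' \<in> nf d (Suc n) None"
        using s by auto
      then have "universal (Suc n) (x # flip x # v')"
        using rarch_nf universality_index_rarch(1) by blast
      then have "(u @ replicate j x @ x # flip x # v', u @ replicate (min j d) x @ x # flip x # v')
          \<in> simon_cong (p + Suc n + d)" if "universal p u" for u p
        using simon_cong_min that by blast
      then have "(u @ replicate (Suc j) x @ flip x # v', u @ replicate (min j d) x @ x # flip x # v')
          \<in> simon_cong (p + Suc n + d)" if "universal p u" for u p
        using that by (simp add: replicate_app_Cons_same)
      then show ?thesis
        using step t by (blast intro: simon_cong_trans)
    qed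
  qed
qed

section \<open>Congruent normal forms are equal\<close>

lemma subseq_Cons_arch_iff:
  "subseq (flip x # s) (replicate j x @ flip x # v) \<longleftrightarrow> subseq s v"
  by (induction j) auto

text \<open>Prefix \<open>s\<close> with the closing letter of the other word's first arch: it
  occurs in this word's first arch, but in the other word only from the arch's end on.\<close>

lemma simon_cong_drop_arch:
  assumes "(replicate (Suc i) x @ flip x # v, replicate (Suc j) y @ flip y # w) \<in> simon_cong (Suc k)"
  shows "(v, w) \<in> simon_cong k"
proof -
  have *: "subseq s w"
    if cong: "(replicate (Suc i) x @ flip x # v, replicate (Suc j) y @ flip y # w) \<in> simon_cong (Suc k)"
      and s: "length s \<le> k" "subseq s v" for i x v j y w s
  proof -
    have "universal 1 (replicate (Suc i) x @ [flip x])"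
      by (rule universal_1[of x]) auto
    then have "subseq [flip y] (replicate (Suc i) x @ [flip x])"
      by (rule universalD) simp
    then have "subseq ([flip y] @ s) ((replicate (Suc i) x @ [flip x]) @ v)"
      using s(2) by (rule list_emb_append_mono)
    then have "subseq (flip y # s) (replicate (Suc j) y @ flip y # w)"
      using simon_congD[OF cong, of "flip y # s"] s(1) by simp
    then show ?thesis
      by (simp only: subseq_Cons_arch_iff)
  qed
  have "(replicate (Suc j) y @ flip y # w, replicate (Suc i) x @ flip x # v) \<in> simon_cong (Suc k)"
    using assms by (auto simp: simon_cong_iff)
  then show ?thesis
    using *[OF assms] * unfolding simon_cong_iff by blast
qed

lemma nf_Suc_None_cases:
  assumes "w \<in> nf d (Suc n) None"
  obtains x s v where "v \<in> nf d n s" "s \<noteq> Some x" "w = x # flip x # v"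
  using assms by auto

text \<open>Two readings of one word: the arch from the left serves to delete it, the rest
  \<open>r\<close> from the right to rebuild the word from its tail.\<close>

lemma nf_Suc_Some_cases:
  assumes "w \<in> nf d (Suc n) (Some x)" "rarch w = (Suc n, r)"
  obtains s v j where "v \<in> nf d n s"
    "w = r @ (if s = Some x then [flip x] else [x, flip x]) @ v"
    "w = replicate (Suc j) x @ flip x # v"
proof -
  consider i v where "v \<in> nf d n (Some x)" "i \<ge> 1" "w = replicate i x @ flip x # v"
    | i v where "v \<in> nf d n None \<union> nf d n (Some (flip x))" "w = replicate i x @ x # flip x # v"
    using assms(1) by auto
  then show ?thesis
  proof cases
    case (1 i v)
    have "rarch w = (Suc n, replicate i x)"
      unfolding 1(3) using rarch_nf[OF 1(1)] by (intro rarch_replicate_append) auto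
    then have r: "r = replicate i x" using assms(2) by simp
    show ?thesis
    proof (rule that[of v "Some x" "i - 1"])
      show "w = r @ (if Some x = Some x then [flip x] else [x, flip x]) @ v"
        using 1 r by simp
    qed (use 1 in auto)
  next
    case (2 i v)
    then have "x # flip x # v \<in> nf d (Suc n) None" by auto
    then have "rarch (x # flip x # v) = (Suc n, [])"
      using rarch_nf by fastforce
    then have "rarch w = (Suc n, replicate i x)"
      unfolding 2(2) by (rule rarch_replicate_append)
    then have r: "r = replicate i x" using assms(2) by simp
    obtain s where s: "v \<in> nf d n s" "s \<noteq> Some x"
      using 2(1) by auto
    show ?thesis
    proof (rule that[of v s i])
      show "w = r @ (if s = Some x then [flip x] else [x, flip x]) @ v"
        using 2 r s by simp
      show "w = replicate (Suc i) x @ flip x # v"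
        using 2 by (simp add: replicate_app_Cons_same)
    qed (fact s)
  qed
qed

text \<open>The rest of \<open>w\<close> followed by an arbitrary word of length \<open>n\<close> is a scattered factor of \<open>w\<close>;
  choosing that word to exhaust the arches of \<open>w'\<close> embeds the rest of \<open>w\<close> into that of \<open>w'\<close>.\<close>

lemma simon_cong_rest_subseq:
  assumes "(w, w') \<in> simon_cong (n + d)" "rarch w = (n, r)" "rarch w' = (n, r')" "length r \<le> d"
  shows "subseq r r'"
proof -
  obtain v where v: "w = r @ v" "universal n v"
    using rarch_universal[OF assms(2)] by blast
  obtain u where u: "length u = n" "\<And>s. subseq (s @ u) w' \<Longrightarrow> subseq s r'"
    using rarch_modus[OF assms(3)] by blast
  have "subseq (r @ u) w"
    using v u(1) universalD[of n v u] by (simp add: list_emb_append_mono)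
  then have "subseq (r @ u) w'"
    using assms(1,4) u(1) by (auto simp: simon_cong_iff)
  then show ?thesis by (rule u(2))
qed

text \<open>Both rests have length at most \<open>d\<close>, so each embeds in the other; the common
  rest determines the type.\<close>

lemma simon_cong_nf_type_eq:
  assumes "(w, w') \<in> simon_cong (n + d)" "w \<in> nf d n t" "w' \<in> nf d n t'"
  obtains r where "rarch w = (n, r)" "rarch w' = (n, r)" "power_type d t r" "t' = t"
proof -
  obtain r where r: "rarch w = (n, r)" "power_type d t r"
    using rarch_nf[OF assms(2)] by blast
  obtain r' where r': "rarch w' = (n, r')" "power_type d t' r'"
    using rarch_nf[OF assms(3)] by blast
  have "(w', w) \<in> simon_cong (n + d)"
    using assms(1) by (auto simp: simon_cong_iff)
  then have "r = r'"
    using simon_cong_rest_subseq[of w w'] simon_cong_rest_subseq[of w' w] assms(1) r r'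
      power_type_length subseq_order.antisym by metis
  then show ?thesis
    using that r r' power_type_unique by blast
qed

text \<open>If \<open>u\<close> exhausts the arches of \<open>v\<close>, then
  \<open>x # flip x # u\<close> separates the words: on the right, \<open>flip x # u\<close> would
  have to fit into \<open>v\<close>, whose rest is empty.\<close>

lemma not_simon_cong_swap:
  assumes "v \<in> nf d n None" "n + 2 \<le> k"
  shows "(x # flip x # v, flip x # x # v) \<notin> simon_cong k"
proof
  assume cong: "(x # flip x # v, flip x # x # v) \<in> simon_cong k"
  have r: "rarch v = (n, [])"
    using rarch_nf[OF assms(1)] by auto
  obtain u where u: "length u = n" "\<And>s. subseq (s @ u) v \<Longrightarrow> subseq s []"
    using rarch_modus[OF r] by blast
  have "subseq u v"
    using universality_index_rarch(1)[OF r] u(1) by (intro universalD) auto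
  then have "subseq (x # flip x # u) (x # flip x # v)" by simp
  then have "subseq (x # flip x # u) (flip x # x # v)"
    using simon_congD[OF cong, of "x # flip x # u"] u(1) assms(2) by simp
  then have "subseq ([flip x] @ u) v" by simp
  then show False using u(2) by fastforce
qed

lemma simon_cong_nf_eq:
  assumes "d \<ge> 1" "(w, w') \<in> simon_cong (n + d)" "w \<in> nf d n t" "w' \<in> nf d n t'"
  shows "w = w'"
  using assms(2-)
proof (induction n arbitrary: w w' t t')
  case 0
  obtain r where "rarch w = (0, r)" "rarch w' = (0, r)" "power_type d t r" "t' = t"
    using simon_cong_nf_type_eq 0 by metis
  moreover have "v = s" if "v \<in> nf d 0 t" "rarch v = (0, s)" for v s
    using that rarch_replicate_append[of "[]" 0] by (cases t) auto
  ultimately show ?case using 0 by blast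
next
  case (Suc n)
  obtain r where r: "rarch w = (Suc n, r)" "rarch w' = (Suc n, r)" and t: "t' = t"
    using simon_cong_nf_type_eq Suc.prems by metis
  have tail: "v = v'"
    if "w = replicate (Suc j) x @ flip x # v" "v \<in> nf d n s"
      "w' = replicate (Suc j') x' @ flip x' # v'" "v' \<in> nf d n s'" for j x v s j' x' v' s'
    using that Suc.IH simon_cong_drop_arch[of j x v j' x' v' "n + d"] Suc.prems(1) by simp
  show ?case
  proof (cases t)
    case None
    obtain x s v where x: "v \<in> nf d n s" "s \<noteq> Some x" "w = x # flip x # v"
      using Suc.prems(2) None nf_Suc_None_cases by metis
    obtain x' s' v' where x': "v' \<in> nf d n s'" "s' \<noteq> Some x'" "w' = x' # flip x' # v'"
      using Suc.prems(3) None t nf_Suc_None_cases by metis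
    have v: "v = v'"
      using tail[of 0 x v s 0 x' v' s'] x x' by simp
    then have s: "s = s'" using nf_type_unique x x' by blast
    show ?thesis
    proof (cases "x = x'")
      case False
      then have x'_eq: "x' = flip x" using neq_iff_flip by metis
      \<comment> \<open>The common tail has type neither \<open>Some x\<close> nor
        \<open>Some (flip x)\<close>.\<close>
      then have "s = None"
        using x x' s UNIV_letter_option_flip[of x] by auto
      then have "(w, w') \<notin> simon_cong (Suc n + d)"
        using not_simon_cong_swap[of v d n "Suc n + d" x] x x' v x'_eq assms(1) by simp
      then show ?thesis using Suc.prems(1) by blast
    qed (use x x' v in simp)
  next
    case (Some x)
    obtain s v j where v: "v \<in> nf d n s"
      "w = r @ (if s = Some x then [flip x] else [x, flip x]) @ v"
      "w = replicate (Suc j) x @ flip x # v"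
      using nf_Suc_Some_cases Suc.prems(2) r(1) Some by metis
    obtain s' v' j' where v': "v' \<in> nf d n s'"
      "w' = r @ (if s' = Some x then [flip x] else [x, flip x]) @ v'"
      "w' = replicate (Suc j') x @ flip x # v'"
      using nf_Suc_Some_cases Suc.prems(3) r(2) Some t by metis
    have "v = v'"
      using tail v v' by blast
    then show ?thesis
      using v(1,2) v'(1,2) nf_type_unique by metis
  qed
qed

section \<open>Counting\<close>

lemma finite_nf [simp]: "finite (nf d n t)"
proof (induction n arbitrary: t)
  case 0
  show ?case by (cases t) auto
next
  case (Suc n)
  have "finite (UNIV :: letter set)"
    using UNIV_letter_flip[of Letter_a] by (metis finite.emptyI finite.insertI)
  then show ?case
    using Suc by (cases t) auto
qed

lemma nf_disjoint: "t \<noteq> t' \<Longrightarrow> nf d n t \<inter> nf d n t' = {}"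
  using nf_type_unique by blast

lemma arch_append_eq_iff:
  "replicate i x @ flip x # v = replicate j x @ flip x # w \<longleftrightarrow> i = j \<and> v = w"
proof (induction i arbitrary: j)
  case 0
  show ?case by (cases j) auto
next
  case (Suc i)
  then show ?case by (cases j) auto
qed

definition nf_total :: "nat \<Rightarrow> nat \<Rightarrow> nat" where
  "nf_total d n = card (\<Union>t. nf d n t)"

lemma nf_total_eq:
  "nf_total d n = card (nf d n None) + card (nf d n (Some x)) + card (nf d n (Some (flip x)))"
proof -
  have "nf_total d n = (\<Sum>t\<in>UNIV. card (nf d n t))"
    unfolding nf_total_def
    by (rule card_UN_disjoint) (auto simp: UNIV_letter_option_flip[of x] dest: nf_type_unique)
  then show ?thesis
    by (simp add: UNIV_letter_option_flip[of x])
qed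

lemma card_nf_union:
  "card (nf d n None \<union> nf d n (Some x)) = card (nf d n None) + card (nf d n (Some x))"
  by (simp add: card_Un_disjoint nf_disjoint)

lemma card_nf_Suc_Some: "card (nf d (Suc n) (Some x)) = d * nf_total d n"
proof -
  define f where "f = (\<lambda>(j, v). replicate j x @ flip x # v)"
  define g where "g = (\<lambda>(j, v). replicate j x @ x # flip x # v)"
  define A where "A = {1..d} \<times> nf d n (Some x)"
  define B where "B = {1..d} \<times> (nf d n None \<union> nf d n (Some (flip x)))"
  have g: "g (j, v) = replicate (Suc j) x @ flip x # v" for j v
    by (simp add: g_def replicate_app_Cons_same)
  have "inj_on f A"
    by (auto simp: inj_on_def f_def arch_append_eq_iff)
  moreover have "inj_on g B"
    by (auto simp: inj_on_def g arch_append_eq_iff simp del: replicate_Suc)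
  \<comment> \<open>Equal words would share their tail, whose type is \<open>Some x\<close> in
    \<open>A\<close> but not in \<open>B\<close>.\<close>
  moreover have "f ` A \<inter> g ` B = {}"
    by (auto simp: f_def g A_def B_def arch_append_eq_iff simp del: replicate_Suc
        dest: nf_type_unique)
  moreover have "finite A" "finite B"
    by (auto simp: A_def B_def)
  ultimately have "card (f ` A \<union> g ` B) = card A + card B"
    by (simp add: card_Un_disjoint card_image)
  moreover have "nf d (Suc n) (Some x) = f ` A \<union> g ` B"
    by (simp add: f_def g_def A_def B_def)
  ultimately show ?thesis
    by (simp add: A_def B_def card_nf_union nf_total_eq[of d n x] algebra_simps)
qed

text \<open>Each letter \<open>x\<close> allows the tails of type other than \<open>Some x\<close>,
  so over both letters only tails of type \<open>None\<close> count twice.\<close>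

lemma card_nf_Suc_None: "card (nf d (Suc n) None) = nf_total d n + card (nf d n None)"
proof -
  define A where "A x = (\<lambda>v. x # flip x # v) ` (nf d n None \<union> nf d n (Some (flip x)))" for x
  have card: "card (A x) = card (nf d n None) + card (nf d n (Some (flip x)))" for x
    by (simp add: A_def card_image inj_on_def card_nf_union)
  have "nf d (Suc n) None = A Letter_a \<union> A Letter_b"
    by (simp add: A_def UNIV_letter_flip[of Letter_a])
  moreover have "A Letter_a \<inter> A Letter_b = {}" "finite (A Letter_a)" "finite (A Letter_b)"
    by (auto simp: A_def)
  ultimately show ?thesis
    using card[of Letter_a] card[of Letter_b]
    by (simp add: card_Un_disjoint nf_total_eq[of d n Letter_a])
qed

lemma card_nf_0: "card (nf d 0 None) = 1" "card (nf d 0 (Some x)) = d"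
  by (simp_all add: card_image inj_on_def)

text \<open>The normal forms with \<open>m\<close> arches are a system of representatives for the
  classes counted.\<close>

lemma num_classes_eq_nf_total:
  assumes "d \<ge> 1"
  shows "num_classes (m + d) m = nf_total d m"
proof -
  let ?R = "simon_cong (m + d)"
  have index: "\<iota> w' = m" if "(w, w') \<in> ?R" "\<iota> w = m" for w w'
  proof -
    have "(w', w) \<in> ?R" using that(1) by (simp add: simon_cong_iff)
    then show ?thesis using simon_cong_universality_index that(2) assms by fastforce
  qed
  have "bij_betw (\<lambda>w. ?R `` {w}) (\<Union>t. nf d m t) {C \<in> UNIV // ?R. \<forall>w\<in>C. \<iota> w = m}"
  proof (rule bij_betw_imageI)
    show "inj_on (\<lambda>w. ?R `` {w}) (\<Union>t. nf d m t)"
    proof (rule inj_onI)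
      fix w w' assume "w \<in> (\<Union>t. nf d m t)" "w' \<in> (\<Union>t. nf d m t)" "?R `` {w} = ?R `` {w'}"
      then show "w = w'"
        using simon_cong_nf_eq[OF assms] eq_equiv_class[OF _ equiv_simon_cong] by blast
    qed
    show "(\<lambda>w. ?R `` {w}) ` (\<Union>t. nf d m t) = {C \<in> UNIV // ?R. \<forall>w\<in>C. \<iota> w = m}"
    proof (intro equalityI subsetI)
      fix C assume "C \<in> (\<lambda>w. ?R `` {w}) ` (\<Union>t. nf d m t)"
      then obtain w t where "w \<in> nf d m t" "C = ?R `` {w}" by blast
      then show "C \<in> {C \<in> UNIV // ?R. \<forall>w\<in>C. \<iota> w = m}"
        using index universality_index_nf by (auto intro: quotientI)
    next
      fix C assume C: "C \<in> {C \<in> UNIV // ?R. \<forall>w\<in>C. \<iota> w = m}"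
      then obtain w where w: "C = ?R `` {w}"
        by (auto elim: quotientE)
      then have m: "\<iota> w = m"
        using C by (auto simp: simon_cong_iff)
      obtain n t w' where w': "w' \<in> nf d n t"
        and cong: "\<forall>u p. universal p u \<longrightarrow> (u @ w, u @ w') \<in> simon_cong (p + n + d)"
        using ex_nf_simon_cong[OF assms] by metis
      from cong have "([] @ w, [] @ w') \<in> simon_cong (0 + n + d)"
        using universal_0 by blast
      then have cong: "(w, w') \<in> simon_cong (n + d)" by simp
      then have n: "n = m"
        using simon_cong_universality_index universality_index_nf[OF w'] m assms by fastforce
      then have "C = ?R `` {w'}"
        using w cong equiv_class_eq[OF equiv_simon_cong] by blast
      then show "C \<in> (\<lambda>w. ?R `` {w}) ` (\<Union>t. nf d m t)"
        using w' n by blast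
    qed
  qed
  then show ?thesis
    unfolding num_classes_def nf_total_def by (simp add: bij_betw_same_card)
qed

section \<open>The matrix formula\<close>

lemma pow_mat_Suc_left:
  assumes "A \<in> carrier_mat n n"
  shows "A ^\<^sub>m Suc m = A * A ^\<^sub>m m"
proof (induction m)
  case 0
  then show ?case using assms by simp
next
  case (Suc m)
  have "A ^\<^sub>m Suc (Suc m) = (A * A ^\<^sub>m m) * A"
    using Suc by simp
  also have "\<dots> = A * A ^\<^sub>m Suc m"
    using assms by (simp add: assoc_mult_mat[of _ n n _ n _ n])
  finally show ?case .
qed

lemma class_mat_mult_vec:
  "class_mat d *\<^sub>v vec_of_list [a, e, b] =
     vec_of_list [d * (a + e + b), a + 2 * e + b, d * (a + e + b)]"
proof (rule eq_vecI)
  fix i assume "i < dim_vec (vec_of_list [d * (a + e + b), a + 2 * e + b, d * (a + e + b)])"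
  then consider "i = 0" | "i = 1" | "i = 2" by fastforce
  then show "(class_mat d *\<^sub>v vec_of_list [a, e, b]) $ i =
      vec_of_list [d * (a + e + b), a + 2 * e + b, d * (a + e + b)] $ i"
    by cases (simp_all add: class_mat_def mat_of_rows_list_def scalar_prod_def
        numeral_3_eq_3 numeral_2_eq_2 algebra_simps)
qed (simp add: class_mat_def mat_of_rows_list_def)

lemma class_mat_carrier: "class_mat d \<in> carrier_mat 3 3"
  by (intro carrier_matI) (simp_all add: class_mat_def mat_of_rows_list_def)

lemma class_mat_pow_mult_vec:
  "class_mat (int d) ^\<^sub>m m *\<^sub>v class_vec (int d) = vec_of_list
     [int (card (nf d m (Some Letter_a))), int (card (nf d m None)), int (card (nf d m (Some Letter_b)))]"
proof (induction m)
  case 0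
  have "class_vec (int d) \<in> carrier_vec 3"
    by (intro carrier_vecI) (simp add: class_vec_def)
  then show ?case
    using class_mat_carrier[of "int d"] by (simp add: card_nf_0 class_vec_def del: nf.simps)
next
  case (Suc m)
  have "class_vec (int d) \<in> carrier_vec 3"
    by (intro carrier_vecI) (simp add: class_vec_def)
  then have "class_mat (int d) ^\<^sub>m Suc m *\<^sub>v class_vec (int d) =
      class_mat (int d) *\<^sub>v (class_mat (int d) ^\<^sub>m m *\<^sub>v class_vec (int d))"
    \<comment> \<open>Powers unfold with the new factor on the right; the induction needs it on the
      left.\<close>
    unfolding pow_mat_Suc_left[OF class_mat_carrier]
    by (intro assoc_mult_mat_vec[of _ 3 3 _ 3] pow_carrier_mat class_mat_carrier)
  also have "\<dots> = vec_of_list [int (card (nf d (Suc m) (Some Letter_a))),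
      int (card (nf d (Suc m) None)), int (card (nf d (Suc m) (Some Letter_b)))]"
    unfolding Suc class_mat_mult_vec card_nf_Suc_Some card_nf_Suc_None
    by (simp add: nf_total_eq[of d m Letter_a] algebra_simps del: nf.simps)
  finally show ?case .
qed

lemma norm_one_class_mat_pow:
  "norm_one (class_mat (int d) ^\<^sub>m m *\<^sub>v class_vec (int d)) = int (nf_total d m)"
  unfolding class_mat_pow_mult_vec norm_one_def
  by (simp add: nf_total_eq[of d m Letter_a] numeral_3_eq_3 del: nf.simps)

section \<open>The recursion for the totals\<close>

lemma nf_total_0: "nf_total d 0 = 2 * d + 1"
  by (simp add: nf_total_eq[of d 0 Letter_a] card_nf_0 del: nf.simps)

lemma nf_total_Suc: "nf_total d (Suc n) = (2 * d + 1) * nf_total d n + card (nf d n None)"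
  by (simp add: nf_total_eq[of d "Suc n" Letter_a] card_nf_Suc_Some card_nf_Suc_None
      algebra_simps del: nf.simps)

text \<open>\<open>nf_total_Suc\<close> eliminates the count of type \<open>None\<close>. The
  coefficients are those of the characteristic polynomial
  \<open>T^3 - 2(d+1) T^2 + 2d T\<close>.\<close>

lemma nf_total_Suc_Suc:
  "int (nf_total d (Suc (Suc n))) =
     2 * (int d + 1) * int (nf_total d (Suc n)) - 2 * int d * int (nf_total d n)"
  unfolding nf_total_Suc[of d "Suc n"] card_nf_Suc_None
  by (simp add: nf_total_Suc algebra_simps)

lemma c_num_eq_nf_total: "c_num (int (n + d)) (int n) = int (nf_total d n)"
proof (induction n rule: induct_nat_012)
  case 0
  show ?case by (simp add: c_num.simps nf_total_0)
next
  case 1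
  \<comment> \<open>The recursion keeps \<open>j - n = d\<close> and here reaches the initial value
    1 at \<open>n = -1\<close>, which has no counterpart in \<open>nf_total\<close>.\<close>
  have "c_num (int (1 + d)) 1 = 2 * (int d + 1) * c_num (int d) 0 - 2 * int d * c_num (int d - 1) (- 1)"
    by (subst c_num.simps) simp
  then show ?case
    by (simp add: c_num.simps[of _ 0] c_num.simps[of _ "- 1"] nf_total_Suc nf_total_0 card_nf_0
        algebra_simps del: nf.simps)
next
  case (ge2 n)
  have "c_num (int (Suc (Suc n) + d)) (int (Suc (Suc n))) =
      2 * (int d + 1) * c_num (int (Suc n + d)) (int (Suc n)) - 2 * int d * c_num (int (n + d)) (int n)"
    by (subst c_num.simps) (simp add: algebra_simps)
  then show ?case
    using ge2 by (simp only: nf_total_Suc_Suc)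
qed

theorem theorem4:
  fixes k m :: nat
  assumes "m < k"
  shows "int (num_classes k m)
           = norm_one ((class_mat (int k - int m) ^\<^sub>m m) *\<^sub>v class_vec (int k - int m))
         \<and> norm_one ((class_mat (int k - int m) ^\<^sub>m m) *\<^sub>v class_vec (int k - int m))
           = c_num (int k) (int m)"
proof -
  define d where "d = k - m"
  have d: "d \<ge> 1" "k = m + d" "int k - int m = int d"
    using assms by (auto simp: d_def)
  show ?thesis
    unfolding d(3) norm_one_class_mat_pow
    using num_classes_eq_nf_total[OF d(1)] c_num_eq_nf_total[of m d] by (simp add: d(2))
qed

end
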